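(* For every $n\ge 1$, the Markov chain $X^0=X^0_{111}$ on $\Omega^0_n$ has the uniform distribution on $\Omega^0_n$ as its stationary distribution.
   Context: A complete configuration of length $n$ is a pair of rows (top and bottom) of $n$ cells each, each cell containing a black ($\bullet$) or a white ($\circ$) particle, such that (i) the two rows together contain $n$ black and $n$ white particles, and (ii) for every $j\in\{0,\dots,n\}$ the first $j$ columns contain at least as many black as white particles. $\Omega^0_n$ is the set of these. Columns are numbered $1,\dots,n$; wall $i\in\{0,\dots,n\}$ lies between columns $i$ and $i+1$ (wall $0$ = left border, wall $n$ = right border); $t_c,b_c$ are the top and bottom particles of column $c$. The map $T:\Omega^0_n\times\{0,\dots,n\}\to\Omega^0_n$ is defined by cases (unmentioned particles keep their relative order in their row): (a') $1\le i\le n-1$, $t_i=\bullet$, $t_{i+1}=\circ$, $b_{i+1}=\bullet$: with $j_1$ the smallest $j\in\{0,\dots,i-1\}$ such that $t_{j+1},\dots,t_{i-1}$ are white, remove column $i+1$ and reinsert it as column $j_1+1$. (a'') $1\le i\le n-1$, $t_i=\bullet$, $t_{i+1}=\circ$, $b_{i+1}=\circ$: with $j_2$ the largest $j\in\{i+1,\dots,n\}$ such that $t_{i+2},\dots,t_j$ are black, delete $t_i$ and insert a black particle as top cell $j_2$; delete $b_{i+1}$ and insert a white particle as bottom cell $j_2+1$ if $j_2<n$, bottom cell $n$ if $j_2=n$. (b) $i=0$, $t_1=\circ$: with $j_2$ the largest $j\in\{1,\dots,n\}$ such that $t_2,\dots,t_j$ are black, delete column $1$, insert a black particle as top cell $j_2$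 and a white particle as bottom cell $j_2+1$ if $j_2<n$, bottom cell $n$ if $j_2=n$. (c) $i=n$, $t_n=\bullet$: with $j_1$ the smallest $j\in\{0,\dots,n-1\}$ such that $t_{j+1},\dots,t_{n-1}$ are white, delete column $n$ and insert a column ($\circ$ on top, $\bullet$ below) as column $j_1+1$. (d) otherwise $T(\omega,i)=\omega$. For $\alpha,\beta,\gamma\in\,]0,1]$ the chain $X^0_{\alpha\beta\gamma}$ on $\Omega^0_n$ evolves as follows: at each time step a wall $i$ is chosen uniformly at random in $\{0,\dots,n\}$, and the next state is $T(X^0_{\alpha\beta\gamma}(t),i)$ with probability $\lambda(i)$ and $X^0_{\alpha\beta\gamma}(t)$ otherwise, where $\lambda(i)=\alpha$ for $1\le i\le n-1$, $\lambda(0)=\beta$, $\lambda(n)=\gamma$. $X^0=X^0_{111}$. *)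

theory Defs
  imports "HOL-Probability.Probability"
begin

datatype particle = Black | White

text \<open>A configuration is the pair of its top row and its bottom row.\<close>

type_synonym config = "particle list \<times> particle list"

text \<open>Cells and columns are numbered from 1.\<close>

definition cell :: "particle list \<Rightarrow> nat \<Rightarrow> particle" where
  "cell r c = r ! (c - 1)"

definition delete_cell :: "nat \<Rightarrow> particle list \<Rightarrow> particle list" where
  "delete_cell c r = take (c - 1) r @ drop c r"

text \<open>The inserted particle is cell \<open>c\<close> of the resulting row.\<close>

definition insert_cell :: "nat \<Rightarrow> particle \<Rightarrow> particle list \<Rightarrow> particle list" where
  "insert_cell c x r = take (c - 1) r @ x # drop (c - 1) r"

definition num_in_columns :: "particle \<Rightarrow> nat \<Rightarrow> config \<Rightarrow> nat" where
  "num_in_columns x j \<omega> =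
     count_list (take j (fst \<omega>)) x + count_list (take j (snd \<omega>)) x"

definition complete_configs :: "nat \<Rightarrow> config set" where
  "complete_configs n =
     {\<omega>. length (fst \<omega>) = n \<and> length (snd \<omega>) = n \<and>
          num_in_columns Black n \<omega> = n \<and> num_in_columns White n \<omega> = n \<and>
          (\<forall>j\<in>{0..n}. num_in_columns White j \<omega> \<le> num_in_columns Black j \<omega>)}"

text \<open>For \<open>1 \<le> i \<le> n\<close> (respectively \<open>0 \<le> i \<le> n - 1\<close>) the sets below contain \<open>i - 1\<close>
  (respectively \<open>i + 1\<close>), so the extrema exist. The case \<open>i = n\<close> of \<open>left_end\<close> and the
  case \<open>i = 0\<close> of \<open>right_end\<close> are those used at the right and left border.\<close>

definition left_end :: "particle list \<Rightarrow> nat \<Rightarrow> nat" where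
  "left_end t i = Min {j \<in> {0..i - 1}. \<forall>k\<in>{j + 1..i - 1}. cell t k = White}"

definition right_end :: "nat \<Rightarrow> particle list \<Rightarrow> nat \<Rightarrow> nat" where
  "right_end n t i = Max {j \<in> {i + 1..n}. \<forall>k\<in>{i + 2..j}. cell t k = Black}"

definition step :: "nat \<Rightarrow> config \<Rightarrow> nat \<Rightarrow> config" where
  "step n \<omega> i =
     (let t = fst \<omega>; b = snd \<omega>; j\<^sub>1 = left_end t i; j\<^sub>2 = right_end n t i;
          w = (if j\<^sub>2 < n then j\<^sub>2 + 1 else n) in
      if 1 \<le> i \<and> i < n \<and> cell t i = Black \<and> cell t (i + 1) = White \<and> cell b (i + 1) = Black then
        (insert_cell (j\<^sub>1 + 1) (cell t (i + 1)) (delete_cell (i + 1) t),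
         insert_cell (j\<^sub>1 + 1) (cell b (i + 1)) (delete_cell (i + 1) b))
      else if 1 \<le> i \<and> i < n \<and> cell t i = Black \<and> cell t (i + 1) = White \<and> cell b (i + 1) = White then
        (insert_cell j\<^sub>2 Black (delete_cell i t),
         insert_cell w White (delete_cell (i + 1) b))
      else if i = 0 \<and> cell t 1 = White then
        (insert_cell j\<^sub>2 Black (delete_cell 1 t),
         insert_cell w White (delete_cell 1 b))
      else if i = n \<and> cell t n = Black then
        (insert_cell (j\<^sub>1 + 1) White (delete_cell n t),
         insert_cell (j\<^sub>1 + 1) Black (delete_cell n b))
      else \<omega>)"

definition wall_rate :: "real \<Rightarrow> real \<Rightarrow> real \<Rightarrow> nat \<Rightarrow> nat \<Rightarrow> real" where
  "wall_rate \<alpha> \<beta> \<gamma> n i = (if i = 0 then \<beta> else if i = n then \<gamma> else \<alpha>)"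

text \<open>The transition kernel of the chain, for parameters in \<open>]0,1]\<close>
  (outside \<open>[0,1]\<close> the rates would be truncated by \<^const>\<open>bernoulli_pmf\<close>).\<close>

definition chain_kernel :: "real \<Rightarrow> real \<Rightarrow> real \<Rightarrow> nat \<Rightarrow> config \<Rightarrow> config pmf" where
  "chain_kernel \<alpha> \<beta> \<gamma> n \<omega> =
     bind_pmf (pmf_of_set {0..n}) (\<lambda>i.
       map_pmf (\<lambda>move. if move then step n \<omega> i else \<omega>) (bernoulli_pmf (wall_rate \<alpha> \<beta> \<gamma> n i)))"

definition stationary_distribution :: "'s set \<Rightarrow> ('s \<Rightarrow> 's pmf) \<Rightarrow> 's pmf \<Rightarrow> bool" where
  "stationary_distribution S K \<pi> \<longleftrightarrow> set_pmf \<pi> \<subseteq> S \<and> bind_pmf \<pi> K = \<pi>"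

text \<open>\<^const>\<open>pmf_of_set\<close> is the uniform distribution only on finite nonempty sets.\<close>

lemma finite_complete_configs: "finite (complete_configs n)"
proof (rule finite_subset)
  have UNIV_particle: "(UNIV :: particle set) = {Black, White}"
    using particle.exhaust by blast
  show "finite ({r. set r \<subseteq> {Black, White} \<and> length r = n} \<times>
                {r. set r \<subseteq> {Black, White} \<and> length r = n})"
    by (intro finite_cartesian_product finite_lists_length_eq) auto
  show "complete_configs n \<subseteq> {r. set r \<subseteq> {Black, White} \<and> length r = n} \<times>
                             {r. set r \<subseteq> {Black, White} \<and> length r = n}"
    using UNIV_particle by (auto simp: complete_configs_def)
qed

lemma complete_configs_nonempty: "complete_configs n \<noteq> {}"
proof -
  have "count_list (replicate m x) y = (if x = y then m else 0)" for m and x y :: particle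
    by (induction m) auto
  then have "(replicate n White, replicate n Black) \<in> complete_configs n"
    by (auto simp: complete_configs_def num_in_columns_def)
  then show ?thesis by blast
qed

end

theory Submission
  imports Defs
begin

text \<open>Record with each transition the wall where the moved particles land: the pair of the new
  configuration and this wall determines the old configuration and the chosen wall. Hence the
  chain is the first component of a permutation of \<open>\<Omega>\<^sup>0\<^sub>n \<times> {0..n}\<close>, so the uniform distribution is
  stationary. Conversely, the maximisers of a stationary distribution are closed under
  predecessors and, by counting along the permutation, under successors; so is their complement.
  From every configuration one reaches the one with a white top row, which therefore belongs to
  every nonempty successor-closed set, and the complement is empty.\<close>

subsection \<open>Chains driven by a permutation\<close>

text \<open>A pair (state, choice) in the support has mass
  \<open>pmf \<pi> (fst q) / card I\<close>, so the new law at \<open>x\<close> adds up these masses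
  over the fibre above \<open>x\<close>. Bijectivity of \<open>F\<close> enters later, through the
  size of the fibres.\<close>

lemma pmf_fst_shuffle:
  fixes F :: "'s \<times> 'i \<Rightarrow> 's \<times> 'i"
  assumes fin: "finite S" "finite I" and ne: "I \<noteq> {}"
    and supp: "set_pmf \<pi> \<subseteq> S"
  shows "pmf (map_pmf (fst \<circ> F) (pair_pmf \<pi> (pmf_of_set I))) x =
    (\<Sum>q | q \<in> S \<times> I \<and> fst (F q) = x. pmf \<pi> (fst q)) / card I"
proof -
  let ?p = "pair_pmf \<pi> (pmf_of_set I)" and ?Q = "{q. q \<in> S \<times> I \<and> fst (F q) = x}"
  have finQ: "finite ?Q"
    using fin by (auto intro: finite_subset[of _ "S \<times> I"])
  have "pmf (map_pmf (fst \<circ> F) ?p) x = measure_pmf.prob ?p ((fst \<circ> F) -` {x})"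
    by (rule pmf_map)
  \<comment> \<open>Only null pairs are discarded, and the event becomes a finite set.\<close>
  also have "\<dots> = measure_pmf.prob ?p ?Q"
    using supp fin ne
    by (intro measure_prob_cong_0) (auto simp: pmf_eq_0_set_pmf)
  also have "\<dots> = (\<Sum>q\<in>?Q. pmf ?p q)"
    by (rule measure_measure_pmf_finite[OF finQ])
  also have "\<dots> = (\<Sum>q\<in>?Q. pmf \<pi> (fst q) / card I)"
    by (intro sum.cong refl) (clarsimp simp: pmf_pair pmf_of_set[OF ne fin(2)])
  finally show ?thesis
    by (simp add: sum_divide_distrib)
qed

text \<open>One step of the chain is an independent random choice followed by a deterministic
  update. Knowing \<open>K\<close> on \<open>S\<close> suffices because \<open>\<pi>\<close> lives
  there.\<close>

lemma bind_shuffle_kernel: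
  assumes "set_pmf \<pi> \<subseteq> S"
    and "\<And>x. x \<in> S \<Longrightarrow> K x = map_pmf (\<lambda>i. fst (F (x, i))) U"
  shows "bind_pmf \<pi> K = map_pmf (fst \<circ> F) (pair_pmf \<pi> U)"
proof -
  have "bind_pmf \<pi> K = bind_pmf \<pi> (\<lambda>x. map_pmf (\<lambda>i. fst (F (x, i))) U)"
    using assms by (intro bind_pmf_cong) auto
  then show ?thesis
    by (simp add: pair_pmf_def map_pmf_def bind_assoc_pmf bind_return_pmf)
qed

text \<open>\<open>F\<close> restricts to a bijection from this set onto
  \<open>A \<times> I\<close>. For a singleton \<open>A\<close> this is double stochasticity: each
  state has exactly \<open>card I\<close> incoming pairs.\<close>

lemma card_fibre_bij:
  assumes "bij_betw F (S \<times> I) (S \<times> I)" "A \<subseteq> S"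
  shows "card {q \<in> S \<times> I. fst (F q) \<in> A} = card (A \<times> I)"
proof -
  have image: "F ` {q \<in> S \<times> I. fst (F q) \<in> A} = A \<times> I"
  proof (intro equalityI subsetI)
    fix y assume "y \<in> F ` {q \<in> S \<times> I. fst (F q) \<in> A}"
    then obtain q where "y = F q" "q \<in> S \<times> I" "fst (F q) \<in> A"
      by blast
    then show "y \<in> A \<times> I"
      using bij_betw_apply[OF assms(1), of q] by (simp add: mem_Times_iff)
  next
    fix y assume y: "y \<in> A \<times> I"
    then have "y \<in> F ` (S \<times> I)"
      using bij_betw_imp_surj_on[OF assms(1)] assms(2) by auto
    then obtain q where "y = F q" "q \<in> S \<times> I"
      by blast
    with y show "y \<in> F ` {q \<in> S \<times> I. fst (F q) \<in> A}"
      by (intro image_eqI[of _ _ q]) (simp_all add: mem_Times_iff)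
  qed
  have "inj_on F {q \<in> S \<times> I. fst (F q) \<in> A}"
    using bij_betw_imp_inj_on[OF assms(1)] by (rule inj_on_subset) auto
  from card_image[OF this] show ?thesis
    unfolding image by (rule sym)
qed

text \<open>Each state of \<open>S\<close> receives \<open>card I\<close> pairs of mass
  \<open>1 / (card S * card I)\<close>, which add up to \<open>1 / card S\<close>.\<close>

lemma uniform_stationary_shuffle:
  assumes fin: "finite S" "finite I" and ne: "S \<noteq> {}" "I \<noteq> {}"
    and bij: "bij_betw F (S \<times> I) (S \<times> I)"
    and K: "\<And>x. x \<in> S \<Longrightarrow> K x = map_pmf (\<lambda>i. fst (F (x, i))) (pmf_of_set I)"
  shows "stationary_distribution S K (pmf_of_set S)"
proof -
  have S: "set_pmf (pmf_of_set S) \<subseteq> S"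
    using fin ne by simp
  have "bind_pmf (pmf_of_set S) K = pmf_of_set S"
  proof (rule pmf_eqI)
    fix x
    have eq: "pmf (bind_pmf (pmf_of_set S) K) x =
        (\<Sum>q | q \<in> S \<times> I \<and> fst (F q) = x. pmf (pmf_of_set S) (fst q)) / card I"
      by (simp add: bind_shuffle_kernel[OF S K] pmf_fst_shuffle[OF fin ne(2) S])
    have sum: "(\<Sum>q | q \<in> S \<times> I \<and> fst (F q) = x. pmf (pmf_of_set S) (fst q)) =
        card {q \<in> S \<times> I. fst (F q) = x} / card S"
      using fin ne by (simp add: sum.cong[OF refl, of _ _ "\<lambda>_. 1 / card S"] mem_Times_iff)
    show "pmf (bind_pmf (pmf_of_set S) K) x = pmf (pmf_of_set S) x"
    proof (cases "x \<in> S")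
      case True
      then have "card {q \<in> S \<times> I. fst (F q) = x} = card I"
        using card_fibre_bij[OF bij, of "{x}"] by (simp add: card_cartesian_product)
      then show ?thesis
        using True fin ne eq sum by simp
    next
      case False
      have "fst (F q) \<in> S" if "q \<in> S \<times> I" for q
        using bij_betw_apply[OF bij that] by (simp add: mem_Times_iff)
      with False have "{q \<in> S \<times> I. fst (F q) = x} = {}"
        by blast
      then show ?thesis
        using False fin ne eq sum by simp
    qed
  qed
  with S show ?thesis
    by (simp add: stationary_distribution_def)
qed

text \<open>A maximum principle. The hypothesis \<open>reach\<close> stands in for irreducibility:
  all nonempty closed subsets share the state \<open>z\<close>, so no two of them are
  disjoint.\<close>

lemma stationary_shuffle_unique:
  assumes fin: "finite S" "finite I" and ne: "I \<noteq> {}"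
    and bij: "bij_betw F (S \<times> I) (S \<times> I)"
    and K: "\<And>x. x \<in> S \<Longrightarrow> K x = map_pmf (\<lambda>i. fst (F (x, i))) (pmf_of_set I)"
    and reach: "\<And>C. C \<subseteq> S \<Longrightarrow> C \<noteq> {} \<Longrightarrow>
      (\<And>x i. x \<in> C \<Longrightarrow> i \<in> I \<Longrightarrow> fst (F (x, i)) \<in> C) \<Longrightarrow> z \<in> C"
    and stat: "stationary_distribution S K \<pi>"
  shows "\<pi> = pmf_of_set S"
proof -
  have S: "set_pmf \<pi> \<subseteq> S" and stat': "bind_pmf \<pi> K = \<pi>"
    using stat by (auto simp: stationary_distribution_def)
  have neS: "S \<noteq> {}"
    using S set_pmf_not_empty[of \<pi>] by blast
  define M where "M = Max (pmf \<pi> ` S)"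
  have le: "pmf \<pi> x \<le> M" if "x \<in> S" for x
    using that fin by (simp add: M_def)
  define A where "A = {x \<in> S. pmf \<pi> x = M}"
  have "M \<in> pmf \<pi> ` S"
    unfolding M_def using fin neS by (intro Max_in) auto
  then have Ane: "A \<noteq> {}"
    by (auto simp: A_def)
  define P where "P = {q \<in> S \<times> I. fst (F q) \<in> A}"
  have F_in: "fst (F (x, i)) \<in> S" if "x \<in> S" "i \<in> I" for x i
    using bij_betw_apply[OF bij, of "(x, i)"] that by (simp add: mem_Times_iff)
  \<comment> \<open>The value at a maximiser is an average over predecessors, so these are maximisers too.\<close>
  have "P \<subseteq> A \<times> I"
  proof
    fix q assume "q \<in> P"
    then have q: "q \<in> S \<times> I" "fst (F q) \<in> S" "pmf \<pi> (fst (F q)) = M"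
      by (auto simp: P_def A_def)
    let ?Q = "{q'. q' \<in> S \<times> I \<and> fst (F q') = fst (F q)}"
    have finQ: "finite ?Q"
      using fin by (auto intro: finite_subset[of _ "S \<times> I"])
    have cardQ: "card ?Q = card I"
      using card_fibre_bij[OF bij, of "{fst (F q)}"] q(2) by (simp add: card_cartesian_product)
    have "M = (\<Sum>q'\<in>?Q. pmf \<pi> (fst q')) / card I"
      using pmf_fst_shuffle[OF fin ne S, of F "fst (F q)"] bind_shuffle_kernel[OF S K] stat' q(3)
      by simp
    \<comment> \<open>The mean of \<open>card I\<close> values, none above \<open>M\<close>, equals
      \<open>M\<close>. The deficits are nonnegative and sum to zero, so each of them
      vanishes.\<close>
    then have "(\<Sum>q'\<in>?Q. M - pmf \<pi> (fst q')) = 0"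
      using fin ne cardQ by (simp add: sum_subtractf field_simps)
    moreover have "0 \<le> M - pmf \<pi> (fst q')" if "q' \<in> ?Q" for q'
      using that le by (auto simp: mem_Times_iff)
    ultimately have "M - pmf \<pi> (fst q) = 0"
      using q(1) sum_nonneg_eq_0_iff[OF finQ, of "\<lambda>q'. M - pmf \<pi> (fst q')"] by blast
    with q show "q \<in> A \<times> I"
      by (auto simp: A_def mem_Times_iff)
  qed
  \<comment> \<open>Equal cardinalities turn the inclusion into an equality, which gives closure
    under successors in addition to closure under predecessors.\<close>
  moreover have "card P = card (A \<times> I)"
    unfolding P_def by (rule card_fibre_bij[OF bij]) (auto simp: A_def)
  moreover have "finite (A \<times> I)"
    using fin by (auto simp: A_def)
  ultimately have P: "P = A \<times> I"
    by (metis card_subset_eq)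
  have "z \<in> A"
  proof (rule reach[OF _ Ane])
    fix x i assume "x \<in> A" "i \<in> I"
    then have "(x, i) \<in> P"
      by (simp add: P)
    then show "fst (F (x, i)) \<in> A"
      by (simp add: P_def)
  qed (auto simp: A_def)
  \<comment> \<open>The equality for \<open>P\<close> also says that no step leads from outside
    \<open>A\<close> into \<open>A\<close>. A nonempty complement would thus be closed and contain
    \<open>z\<close> as well.\<close>
  have "S - A = {}"
  proof (rule ccontr)
    assume "S - A \<noteq> {}"
    moreover have "fst (F (x, i)) \<in> S - A" if "x \<in> S - A" "i \<in> I" for x i
    proof -
      have "(x, i) \<notin> P"
        using that P by auto
      then show ?thesis
        using that F_in by (auto simp: P_def)
    qed
    ultimately have "z \<in> S - A"
      by (intro reach[of "S - A"]) auto
    with \<open>z \<in> A\<close> show False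
      by simp
  qed
  then have const: "pmf \<pi> x = M" if "x \<in> S" for x
    using that by (auto simp: A_def)
  have "1 = (\<Sum>x\<in>S. pmf \<pi> x)"
    using sum_pmf_eq_1[OF fin(1) S] by simp
  also have "\<dots> = card S * M"
    using const by simp
  finally have M: "M = 1 / card S"
    using fin neS by (simp add: field_simps)
  show ?thesis
  proof (rule pmf_eqI)
    fix x
    show "pmf \<pi> x = pmf (pmf_of_set S) x"
      using const M fin neS S by (cases "x \<in> S") (auto simp: pmf_eq_0_set_pmf)
  qed
qed

subsection \<open>Rows and their height functions\<close>

lemma length_insert_cell:
  "1 \<le> c \<Longrightarrow> c \<le> length r + 1 \<Longrightarrow> length (insert_cell c x r) = length r + 1"
  by (auto simp: insert_cell_def)

lemma length_delete_cell:
  "1 \<le> c \<Longrightarrow> c \<le> length r \<Longrightarrow> length (delete_cell c r) = length r - 1"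
  by (auto simp: delete_cell_def)

lemma cell_insert_cell:
  assumes "1 \<le> c" "c \<le> length r + 1" "1 \<le> m"
  shows "cell (insert_cell c x r) m =
    (if m < c then cell r m else if m = c then x else cell r (m - 1))"
proof -
  define a b where "a = take (c - 1) r" and "b = drop (c - 1) r"
  have r: "r = a @ b" and c: "c = Suc (length a)"
    using assms by (auto simp: a_def b_def)
  obtain k where m: "m = Suc k"
    using assms(3) by (cases m) auto
  show ?thesis
    by (cases k) (auto simp: cell_def insert_cell_def r c m nth_append nth_Cons' less_Suc_eq)
qed

lemma cell_delete_cell:
  assumes "1 \<le> c" "c \<le> length r" "1 \<le> m"
  shows "cell (delete_cell c r) m = (if m < c then cell r m else cell r (m + 1))"
proof -
  define a b where "a = take (c - 1) r" and "b = drop c r"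
  have r: "r = a @ r ! (c - 1) # b" and c: "c = Suc (length a)"
    using assms id_take_nth_drop[of "c - 1" r] by (auto simp: a_def b_def)
  obtain k where m: "m = Suc k"
    using assms(3) by (cases m) auto
  have "cell (a @ b) m = (if m < c then cell (a @ y # b) m else cell (a @ y # b) (m + 1))" for y
    by (auto simp: cell_def c m nth_append Suc_diff_le)
  moreover have "delete_cell c r = a @ b"
    by (simp add: delete_cell_def a_def b_def)
  ultimately show ?thesis
    using r by metis
qed

lemma row_eqI:
  assumes "length r = n" "length s = n" "\<And>m. 1 \<le> m \<Longrightarrow> m \<le> n \<Longrightarrow> cell r m = cell s m"
  shows "r = s"
proof (rule nth_equalityI)
  show "r ! k = s ! k" if "k < length r" for k
    using assms(3)[of "Suc k"] assms(1,2) that by (simp add: cell_def)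
qed (use assms in simp)

lemma insert_cell_inject:
  assumes "insert_cell c x r = insert_cell c y s" "1 \<le> c" "c \<le> length r + 1" "length r = length s"
  shows "r = s"
proof -
  have "take (c - 1) r = take (c - 1) s \<and> drop (c - 1) r = drop (c - 1) s"
    using assms unfolding insert_cell_def by (subst (asm) append_eq_append_conv) auto
  then show ?thesis
    by (metis append_take_drop_id)
qed

lemma delete_cell_inject:
  assumes "delete_cell c r = delete_cell c s" "cell r c = cell s c" "1 \<le> c" "c \<le> length r"
    "length r = length s"
  shows "r = s"
proof (rule row_eqI[of _ "length r"])
  fix m assume m: "1 \<le> m" "m \<le> length r"
  consider "m < c" | "m = c" | "m > c" by linarith
  then show "cell r m = cell s m"
  proof cases
    case 1
    then show ?thesis
      using m assms cell_delete_cell[of c r m] cell_delete_cell[of c s m] by simp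
  next
    case 3
    then show ?thesis
      using m assms cell_delete_cell[of c r "m - 1"] cell_delete_cell[of c s "m - 1"]
      by (cases m) auto
  qed (use assms in simp)
qed (use assms in auto)

section \<open>Charges, heights and complete configurations\<close>

fun charge :: "particle \<Rightarrow> int" where
  "charge Black = 1"
| "charge White = - 1"

lemma charge_bounds: "- 1 \<le> charge x" "charge x \<le> 1"
  by (cases x; simp)+

lemma not_Black_iff: "x \<noteq> Black \<longleftrightarrow> x = White"
  by (cases x) auto

lemma not_White_iff: "x \<noteq> White \<longleftrightarrow> x = Black"
  by (cases x) auto

text \<open>The lattice path of a row, with an up-step for black and a down-step for white. A
  complete configuration is a pair of paths whose sum stays nonnegative and ends at zero.\<close>

definition height :: "particle list \<Rightarrow> nat \<Rightarrow> int" where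
  "height r j = (\<Sum>k=1..j. charge (cell r k))"

lemma height_0 [simp]: "height r 0 = 0"
  by (simp add: height_def)

lemma height_Suc: "height r (Suc j) = height r j + charge (cell r (Suc j))"
  by (simp add: height_def)

lemma height_count:
  assumes "j \<le> length r"
  shows "height r j = int (count_list (take j r) Black) - int (count_list (take j r) White)"
    and "count_list (take j r) Black + count_list (take j r) White = j"
  using assms
proof (induction j)
  case (Suc j)
  {
    case 1
    then show ?case
      using Suc.IH(1) by (cases "r ! j") (auto simp: height_Suc cell_def take_Suc_conv_app_nth)
  next
    case 2
    then show ?case
      using Suc.IH(2) by (cases "r ! j") (auto simp: take_Suc_conv_app_nth)
  }
qed auto

text \<open>The first \<open>j\<close> columns hold \<open>2 * j\<close> particles, so the total
  height at \<open>n\<close> vanishes exactly when both colours occur \<open>n\<close>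
  times.\<close>

lemma complete_configs_iff:
  "(t, b) \<in> complete_configs n \<longleftrightarrow>
    length t = n \<and> length b = n \<and> height t n + height b n = 0 \<and>
    (\<forall>j\<le>n. 0 \<le> height t j + height b j)"
proof (cases "length t = n \<and> length b = n")
  case True
  have h: "height t j + height b j =
      int (num_in_columns Black j (t, b)) - int (num_in_columns White j (t, b))"
    "num_in_columns Black j (t, b) + num_in_columns White j (t, b) = 2 * j" if "j \<le> n" for j
    using height_count[of j t] height_count[of j b] that True by (auto simp: num_in_columns_def)
  have "num_in_columns Black n (t, b) = n \<and> num_in_columns White n (t, b) = n \<longleftrightarrow>
      height t n + height b n = 0"
    using h[of n] by linarith
  moreover have "(\<forall>j\<in>{0..n}. num_in_columns White j (t, b) \<le> num_in_columns Black j (t, b)) \<longleftrightarrow>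
      (\<forall>j\<le>n. 0 \<le> height t j + height b j)"
    using h(1) by auto
  ultimately show ?thesis
    using True by (auto simp: complete_configs_def)
qed (auto simp: complete_configs_def)

lemma height_insert_cell:
  assumes "1 \<le> c" "c \<le> length r + 1"
  shows "height (insert_cell c x r) j = (if j < c then height r j else height r (j - 1) + charge x)"
proof (induction j)
  case (Suc j)
  show ?case
  proof (cases "Suc j = c")
    case True
    then have "height (insert_cell c x r) j = height r j" "c - 1 = j"
        "height s c = height s j + charge (cell s c)" for s
      using Suc height_Suc[of s j] by simp_all
    with True assms show ?thesis
      by (simp add: cell_insert_cell[OF assms])
  next
    case False
    with Suc assms show ?thesis
      by (cases j) (auto simp: height_Suc cell_insert_cell[OF assms])
  qed
qed (use assms in auto)

lemma height_delete_cell: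
  assumes "1 \<le> c" "c \<le> length r"
  shows "height (delete_cell c r) j =
    (if j < c then height r j else height r (Suc j) - charge (cell r c))"
proof (induction j)
  case (Suc j)
  show ?case
  proof (cases "Suc j = c")
    case True
    then have "height (delete_cell c r) j = height r j" "c - 1 = j"
        "height s c = height s j + charge (cell s c)" for s
      using Suc height_Suc[of s j] by simp_all
    with True assms show ?thesis
      by (simp add: cell_delete_cell[OF assms] height_Suc[of r c])
  next
    case False
    with Suc assms show ?thesis
      by (auto simp: height_Suc cell_delete_cell[OF assms])
  qed
qed (use assms in auto)

section \<open>Monochromatic runs next to a wall\<close>

lemma left_end:
  assumes "1 \<le> i"
  shows "left_end t i < i" "\<And>k. left_end t i < k \<Longrightarrow> k < i \<Longrightarrow> cell t k = White"
    "0 < left_end t i \<Longrightarrow> cell t (left_end t i) = Black"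
proof -
  let ?J = "{j \<in> {0..i - 1}. \<forall>k\<in>{j + 1..i - 1}. cell t k = White}"
  have "i - 1 \<in> ?J" by auto
  then have "left_end t i \<in> ?J"
    unfolding left_end_def by (intro Min_in) auto
  then show "left_end t i < i" and w: "\<And>k. left_end t i < k \<Longrightarrow> k < i \<Longrightarrow> cell t k = White"
    using assms by auto
  \<comment> \<open>Minimality: if this cell were white, the wall to its left would be admissible
    too.\<close>
  show "cell t (left_end t i) = Black" if pos: "0 < left_end t i"
  proof (rule ccontr)
    assume "cell t (left_end t i) \<noteq> Black"
    then have "cell t k = White" if "left_end t i - 1 < k" "k < i" for k
      using w[of k] that pos by (cases "k = left_end t i") (auto simp: not_Black_iff)
    then have "left_end t i - 1 \<in> ?J"
      using \<open>left_end t i < i\<close> pos by auto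
    then have "Min ?J \<le> left_end t i - 1"
      by (intro Min_le) simp_all
    then have "left_end t i \<le> left_end t i - 1"
      by (subst left_end_def)
    with pos show False by simp
  qed
qed

lemma right_end:
  assumes "i < n"
  shows "i < right_end n t i" "right_end n t i \<le> n"
    "\<And>k. i + 1 < k \<Longrightarrow> k \<le> right_end n t i \<Longrightarrow> cell t k = Black"
    "right_end n t i < n \<Longrightarrow> cell t (right_end n t i + 1) = White"
proof -
  let ?J = "{j \<in> {i + 1..n}. \<forall>k\<in>{i + 2..j}. cell t k = Black}"
  have "i + 1 \<in> ?J" using assms by auto
  then have "right_end n t i \<in> ?J"
    unfolding right_end_def by (intro Max_in) auto
  then show *: "i < right_end n t i" "right_end n t i \<le> n"
    and w: "\<And>k. i + 1 < k \<Longrightarrow> k \<le> right_end n t i \<Longrightarrow> cell t k = Black"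
    by auto
  \<comment> \<open>Maximality: a black cell here would make the next wall admissible too.\<close>
  show "cell t (right_end n t i + 1) = White" if lt: "right_end n t i < n"
  proof (rule ccontr)
    assume "cell t (right_end n t i + 1) \<noteq> White"
    then have "cell t k = Black" if "i + 1 < k" "k \<le> right_end n t i + 1" for k
      using w[of k] that by (cases "k = right_end n t i + 1") (auto simp: not_White_iff)
    then have "right_end n t i + 1 \<in> ?J"
      using * lt by auto
    then have "right_end n t i + 1 \<le> Max ?J"
      by (intro Max_ge) simp_all
    then have "right_end n t i + 1 \<le> right_end n t i"
      by (subst (2) right_end_def)
    then show False by simp
  qed
qed

subsection \<open>The permutation behind the chain\<close>

text \<open>The first branch serves (a') and (c), the second (a'') and (b); the guarded implications
  skip the cell that is missing at a border. An idle wall is its own target, so that idle pairs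
  become fixed points.\<close>

definition target_wall :: "nat \<Rightarrow> config \<Rightarrow> nat \<Rightarrow> nat" where
  "target_wall n \<omega> i =
    (let t = fst \<omega>; b = snd \<omega> in
     if 0 < i \<and> cell t i = Black \<and> (i < n \<longrightarrow> cell t (i + 1) = White \<and> cell b (i + 1) = Black)
     then left_end t i
     else if i < n \<and> (0 < i \<longrightarrow> cell t i = Black) \<and> cell t (i + 1) = White
     then right_end n t i
     else i)"

text \<open>Cases (a') and (c) are treated at once as left moves, cases (a'') and (b) as right moves:
  in each pair the removed black and white particles are merely exchanged at the border.\<close>

definition left_move :: "nat \<Rightarrow> config \<Rightarrow> nat \<Rightarrow> config \<Rightarrow> nat \<Rightarrow> bool" where
  "left_move n \<omega> i \<omega>' j \<longleftrightarrow>
    (\<exists>d. 1 \<le> i \<and> i \<le> n \<and> d = min (i + 1) n \<and> j = left_end (fst \<omega>) i \<and>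
      cell (fst \<omega>) i = Black \<and>
      cell (fst \<omega>) d = (if i < n then White else Black) \<and>
      cell (snd \<omega>) d = (if i < n then Black else White) \<and>
      \<omega>' = (insert_cell (j + 1) White (delete_cell d (fst \<omega>)),
            insert_cell (j + 1) Black (delete_cell d (snd \<omega>))))"

definition right_move :: "nat \<Rightarrow> config \<Rightarrow> nat \<Rightarrow> config \<Rightarrow> nat \<Rightarrow> bool" where
  "right_move n \<omega> i \<omega>' j \<longleftrightarrow>
    (\<exists>d. i < n \<and> d = max i 1 \<and> j = right_end n (fst \<omega>) i \<and>
      cell (fst \<omega>) (i + 1) = White \<and>
      cell (fst \<omega>) d = (if 0 < i then Black else White) \<and>
      cell (snd \<omega>) (i + 1) = (if 0 < i then White else Black) \<and>
      \<omega>' = (insert_cell j Black (delete_cell d (fst \<omega>)),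
            insert_cell (min (j + 1) n) White (delete_cell (i + 1) (snd \<omega>))))"

text \<open>Imagine a black particle left of wall 0 and a white one right of wall \<open>n\<close>.
  A wall is idle unless it then has black on its left and white on its right in the top row.\<close>

definition no_move :: "nat \<Rightarrow> config \<Rightarrow> nat \<Rightarrow> config \<Rightarrow> nat \<Rightarrow> bool" where
  "no_move n \<omega> i \<omega>' j \<longleftrightarrow> \<omega>' = \<omega> \<and> j = i \<and> i \<le> n \<and>
    \<not> ((0 < i \<longrightarrow> cell (fst \<omega>) i = Black) \<and> (i < n \<longrightarrow> cell (fst \<omega>) (i + 1) = White))"

text \<open>Away from the borders this only regroups the cases of the map. At a border the bottom
  particle of the deleted column is not prescribed and has to be deduced from completeness.\<close>

lemma step_cases:
  assumes "1 \<le> n" "\<omega> \<in> complete_configs n" "i \<le> n"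
  shows "left_move n \<omega> i (step n \<omega> i) (target_wall n \<omega> i) \<or>
    right_move n \<omega> i (step n \<omega> i) (target_wall n \<omega> i) \<or>
    no_move n \<omega> i (step n \<omega> i) (target_wall n \<omega> i)"
proof -
  obtain t b where \<omega>: "\<omega> = (t, b)" by (cases \<omega>)
  have ht: "height t n + height b n = 0" "\<And>j. j \<le> n \<Longrightarrow> 0 \<le> height t j + height b j"
    using assms(2) by (auto simp: \<omega> complete_configs_iff)
  \<comment> \<open>The first column alone must have nonnegative height.\<close>
  have first: "cell b 1 = Black" if "cell t 1 = White"
    using ht(2)[of 1] assms(1) that height_Suc[of t 0] height_Suc[of b 0]
    by (cases "cell b 1") auto
  \<comment> \<open>The total height is nonnegative before the last column and zero after it, so
    this column is not black twice.\<close>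
  have last: "cell b n = White" if "cell t n = Black"
    using ht(1) ht(2)[of "n - 1"] assms(1) that height_Suc[of t "n - 1"] height_Suc[of b "n - 1"]
    by (cases "cell b n") auto
  consider "i = 0" "cell t 1 = White" | "i = n" "cell t n = Black"
    | "0 < i" "i < n" "cell t i = Black" "cell t (i + 1) = White" "cell b (i + 1) = Black"
    | "0 < i" "i < n" "cell t i = Black" "cell t (i + 1) = White" "cell b (i + 1) = White"
    | "\<not> ((0 < i \<longrightarrow> cell t i = Black) \<and> (i < n \<longrightarrow> cell t (i + 1) = White))"
    using assms(1,3) by (cases "i = 0"; cases "i = n"; cases "cell b (i + 1)") auto
  then show ?thesis
  proof cases
    case 1
    then have "right_move n \<omega> i (step n \<omega> i) (target_wall n \<omega> i)"
      using assms(1) first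
      by (auto simp: right_move_def \<omega> step_def target_wall_def Let_def min_def)
    then show ?thesis by simp
  next
    case 2
    then have "left_move n \<omega> i (step n \<omega> i) (target_wall n \<omega> i)"
      using assms(1) last
      by (auto simp: left_move_def \<omega> step_def target_wall_def Let_def min_def)
    then show ?thesis by simp
  next
    case 3
    then have "left_move n \<omega> i (step n \<omega> i) (target_wall n \<omega> i)"
      by (auto simp: left_move_def \<omega> step_def target_wall_def Let_def min_def)
    then show ?thesis by simp
  next
    case 4
    then have "right_move n \<omega> i (step n \<omega> i) (target_wall n \<omega> i)"
      using right_end(1,2)[of i n t] max_absorb1[of 1 i]
      by (auto simp: right_move_def \<omega> step_def target_wall_def Let_def min_def)
    then show ?thesis by simp
  next
    case 5
    then have "no_move n \<omega> i (step n \<omega> i) (target_wall n \<omega> i)"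
      using assms by (auto simp: no_move_def \<omega> step_def target_wall_def Let_def)
    then show ?thesis by simp
  qed
qed

text \<open>Column \<open>d\<close> and the inserted column both have charge zero. Moving such a
  column from \<open>d\<close> to \<open>j + 1\<close> only shifts the total heights between these
  places, so every new value is an old one.\<close>

lemma left_move_complete:
  assumes "left_move n \<omega> i \<omega>' j" "\<omega> \<in> complete_configs n"
  shows "\<omega>' \<in> complete_configs n"
proof -
  obtain t b where \<omega>: "\<omega> = (t, b)" by (cases \<omega>)
  have len: "length t = n" "length b = n"
    and ht: "height t n + height b n = 0" "\<And>j. j \<le> n \<Longrightarrow> 0 \<le> height t j + height b j"
    using assms(2) by (auto simp: \<omega> complete_configs_iff)
  obtain d where d: "1 \<le> i" "i \<le> n" "d = min (i + 1) n" "j = left_end t i"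
      "charge (cell t d) + charge (cell b d) = 0"
    and \<omega>': "\<omega>' = (insert_cell (j + 1) White (delete_cell d t),
                    insert_cell (j + 1) Black (delete_cell d b))"
    using assms(1) by (auto simp: left_move_def \<omega>)
  have j: "1 \<le> j + 1" "j + 1 \<le> d" "1 \<le> d" "d \<le> n"
    using d left_end(1)[of i t] by auto
  have eq: "height (fst \<omega>') k + height (snd \<omega>') k =
      (if j < k \<and> k \<le> d then height t (k - 1) + height b (k - 1) else height t k + height b k)" for k
    using j len d(5)
    by (auto simp: \<omega>' height_insert_cell length_delete_cell height_delete_cell)
  \<comment> \<open>If \<open>d = n\<close>, the new final height is the old one at
    \<open>n - 1\<close>, which is zero because the last column is neutral.\<close>
  have "height (fst \<omega>') n + height (snd \<omega>') n = 0"
    unfolding eq using ht(1) ht(2)[of "n - 1"] j d(5) height_Suc[of t "n - 1"] height_Suc[of b "n - 1"]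
    by (auto dest!: le_antisym)
  moreover have "0 \<le> height (fst \<omega>') k + height (snd \<omega>') k" if "k \<le> n" for k
    unfolding eq using ht(2) that by auto
  ultimately show ?thesis
    using j len by (auto simp: \<omega>' complete_configs_iff length_insert_cell length_delete_cell)
qed

text \<open>The two rows change at different columns, but the new total height at \<open>k\<close>
  is still an old one, at \<open>k\<close> or at \<open>k + 1\<close>, except at
  \<open>k = j < n\<close>. There the white bottom cell comes one column after the black top cell,
  which adds 1 plus the charge of the old bottom cell \<open>j + 1\<close>, a nonnegative
  amount.\<close>

lemma right_move_complete:
  assumes "right_move n \<omega> i \<omega>' j" "\<omega> \<in> complete_configs n"
  shows "\<omega>' \<in> complete_configs n"
proof -
  obtain t b where \<omega>: "\<omega> = (t, b)" by (cases \<omega>)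
  have len: "length t = n" "length b = n"
    and ht: "height t n + height b n = 0" "\<And>j. j \<le> n \<Longrightarrow> 0 \<le> height t j + height b j"
    using assms(2) by (auto simp: \<omega> complete_configs_iff)
  obtain d where d: "i < n" "d = max i 1" "j = right_end n t i"
      "charge (cell t d) + charge (cell b (i + 1)) = 0" "0 < i \<Longrightarrow> charge (cell t d) = 1"
    and \<omega>': "\<omega>' = (insert_cell j Black (delete_cell d t),
                    insert_cell (min (j + 1) n) White (delete_cell (i + 1) b))"
    using assms(1) by (auto simp: right_move_def \<omega> split: if_splits)
  have j: "i < j" "d \<le> j" "j \<le> n" "1 \<le> d" "d \<le> n"
    using d right_end(1,2)[of i n t] by auto
  have top: "height (fst \<omega>') k =
      (if k < d then height t k else if k < j then height t (k + 1) - charge (cell t d)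
       else height t k - charge (cell t d) + 1)" for k
    using j len height_Suc[of t "d - 1"]
    by (cases "k = d") (auto simp: \<omega>' height_insert_cell length_delete_cell height_delete_cell)
  have bot: "height (snd \<omega>') k =
      (if k \<le> i then height b k
       else if k < min (j + 1) n then height b (k + 1) - charge (cell b (i + 1))
       else height b k - charge (cell b (i + 1)) - 1)" for k
    using j len height_Suc[of b i]
    by (cases "k = i + 1") (auto simp: \<omega>' height_insert_cell length_delete_cell height_delete_cell)
  have "height (fst \<omega>') n + height (snd \<omega>') n = 0"
    using ht(1) j d(1,4) by (auto simp: top bot)
  moreover have "0 \<le> height (fst \<omega>') k + height (snd \<omega>') k" if k: "k \<le> n" for k
  proof -
    consider "k < d" "k \<le> i" | "0 < i" "k = i" | "i < k" "k < j" | "k = j" "k < n" | "j \<le> k" "k = n" | "j < k"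
      using k j d by linarith
    then show ?thesis
    proof cases
      case 1
      then show ?thesis using ht(2) k by (simp add: top bot)
    next
      \<comment> \<open>Here the top row is already shifted and the bottom row is not yet. As the
        bottom cell \<open>i + 1\<close> is white, the sum is nevertheless the old one at
        \<open>i + 1\<close>.\<close>
      case 2
      then show ?thesis
        using ht(2)[of "k + 1"] d j height_Suc[of b i] by (auto simp: top bot)
    next
      case 3
      then show ?thesis
        using ht(2)[of "k + 1"] d(4) j d(2) by (auto simp: top bot)
    next
      \<comment> \<open>The exceptional wall, where the bound on a single charge is used.\<close>
      case 4
      then show ?thesis
        using ht(2)[of k] d(4) j charge_bounds[of "cell b (k + 1)"] height_Suc[of b k]
        by (auto simp: top bot)
    next
      case 5
      then show ?thesis
        using ht(2)[of k] d(1,4) j by (auto simp: top bot)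
    next
      case 6
      then show ?thesis
        using ht(2)[of k] d(4) j k by (auto simp: top bot)
    qed
  qed
  ultimately show ?thesis
    using j len d(1) by (auto simp: \<omega>' complete_configs_iff length_insert_cell length_delete_cell)
qed

lemma step_complete:
  assumes "1 \<le> n" "\<omega> \<in> complete_configs n" "i \<le> n"
  shows "step n \<omega> i \<in> complete_configs n" "target_wall n \<omega> i \<le> n"
proof -
  show "step n \<omega> i \<in> complete_configs n"
    using step_cases[OF assms] assms(2)
    by (auto simp: no_move_def intro: left_move_complete right_move_complete)
  show "target_wall n \<omega> i \<le> n"
    using step_cases[OF assms] left_end(1)[of i "fst \<omega>"] right_end(2)[of i n "fst \<omega>"]
    by (auto simp: no_move_def left_move_def right_move_def)
qed

text \<open>These are the traces by which the move can be undone. The inserted white cell prolongs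
  the white run that was passed, and the old black cell \<open>i\<close> is pushed to
  \<open>i + 1\<close>; hence \<open>i\<close> is where the white run starting at wall
  \<open>j\<close> ends. The colours around \<open>j\<close> identify the kind of move.\<close>

lemma left_move_image:
  assumes "left_move n \<omega> i \<omega>' j" "\<omega> \<in> complete_configs n"
  shows "j < i" "i \<le> n" "0 < j \<Longrightarrow> cell (fst \<omega>') j = Black"
    "cell (fst \<omega>') (j + 1) = White" "cell (snd \<omega>') (j + 1) = Black"
    "\<And>m. j < m \<Longrightarrow> m \<le> i \<Longrightarrow> cell (fst \<omega>') m = White"
    "i < n \<Longrightarrow> cell (fst \<omega>') (i + 1) = Black"
proof -
  obtain t b where \<omega>: "\<omega> = (t, b)" by (cases \<omega>)
  have len: "length t = n" "length b = n"
    using assms(2) by (auto simp: \<omega> complete_configs_iff)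
  obtain d where d: "1 \<le> i" "i \<le> n" "d = min (i + 1) n" "j = left_end t i" "cell t i = Black"
    and \<omega>': "\<omega>' = (insert_cell (j + 1) White (delete_cell d t),
                    insert_cell (j + 1) Black (delete_cell d b))"
    using assms(1) by (auto simp: left_move_def \<omega>)
  have j: "1 \<le> j + 1" "j + 1 \<le> d" "1 \<le> d" "d \<le> n"
    using d left_end(1)[of i t] by auto
  show "j < i" "i \<le> n"
    using d left_end(1)[of i t] by auto
  show "cell (fst \<omega>') j = Black" if "0 < j"
    using that j len left_end(3)[of i t] d
    by (auto simp: \<omega>' cell_insert_cell length_delete_cell cell_delete_cell)
  show "cell (fst \<omega>') (j + 1) = White" "cell (snd \<omega>') (j + 1) = Black"
    using j len by (auto simp: \<omega>' cell_insert_cell length_delete_cell cell_delete_cell)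
  show "cell (fst \<omega>') m = White" if "j < m" "m \<le> i" for m
    using that j len left_end(2)[of i t "m - 1"] d
    by (auto simp: \<omega>' cell_insert_cell length_delete_cell cell_delete_cell)
  show "cell (fst \<omega>') (i + 1) = Black" if "i < n"
    using that j len d left_end(1)[of i t]
    by (auto simp: \<omega>' cell_insert_cell length_delete_cell cell_delete_cell)
qed

text \<open>Here \<open>i\<close> is the left end of the black run ending at wall \<open>j\<close>:
  deleting the cell left of the run moves the white cell \<open>i + 1\<close> to place
  \<open>i\<close>, or removes it when \<open>i = 0\<close>. For \<open>j < n\<close>, column
  \<open>j + 1\<close> becomes white in both rows.\<close>

lemma right_move_image:
  assumes "right_move n \<omega> i \<omega>' j" "\<omega> \<in> complete_configs n"
  shows "i < j" "j \<le> n" "j < n \<Longrightarrow> cell (fst \<omega>') (j + 1) = White"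
    "j < n \<Longrightarrow> cell (snd \<omega>') (j + 1) = White"
    "\<And>m. i < m \<Longrightarrow> m \<le> j \<Longrightarrow> cell (fst \<omega>') m = Black"
    "0 < i \<Longrightarrow> cell (fst \<omega>') i = White"
proof -
  obtain t b where \<omega>: "\<omega> = (t, b)" by (cases \<omega>)
  have len: "length t = n" "length b = n"
    using assms(2) by (auto simp: \<omega> complete_configs_iff)
  obtain d where d: "i < n" "d = max i 1" "j = right_end n t i" "cell t (i + 1) = White"
    and \<omega>': "\<omega>' = (insert_cell j Black (delete_cell d t),
                    insert_cell (min (j + 1) n) White (delete_cell (i + 1) b))"
    using assms(1) by (auto simp: right_move_def \<omega>)
  have j: "i < j" "d \<le> j" "j \<le> n" "1 \<le> j" "1 \<le> d" "d \<le> n"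
    using d right_end(1,2)[of i n t] by auto
  show "i < j" "j \<le> n" using j by auto
  show "cell (fst \<omega>') (j + 1) = White" if "j < n"
    using that j len right_end(4)[of i n t] d
    by (auto simp: \<omega>' cell_insert_cell length_delete_cell cell_delete_cell)
  show "cell (snd \<omega>') (j + 1) = White" if "j < n"
    using that j len d by (auto simp: \<omega>' cell_insert_cell length_delete_cell cell_delete_cell)
  show "cell (fst \<omega>') m = Black" if "i < m" "m \<le> j" for m
    using that j len right_end(3)[where k = "m + 1" and t = t and i = i and n = n] d
    by (auto simp: \<omega>' cell_insert_cell length_delete_cell cell_delete_cell)
  show "cell (fst \<omega>') i = White" if "0 < i"
    using that j len d by (auto simp: \<omega>' cell_insert_cell length_delete_cell cell_delete_cell)
qed

text \<open>If the two walls differed, the cell right of the smaller one would be both black and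
  white. Once the wall is known, so are the deleted position and the deleted particles, and the
  insertion and the deletion can be undone.\<close>

lemma left_move_inject:
  assumes "left_move n \<omega>\<^sub>1 i\<^sub>1 \<omega>' j" "left_move n \<omega>\<^sub>2 i\<^sub>2 \<omega>' j"
    "\<omega>\<^sub>1 \<in> complete_configs n" "\<omega>\<^sub>2 \<in> complete_configs n"
  shows "\<omega>\<^sub>1 = \<omega>\<^sub>2 \<and> i\<^sub>1 = i\<^sub>2"
proof -
  note im1 = left_move_image[OF assms(1,3)] and im2 = left_move_image[OF assms(2,4)]
  have i: "i\<^sub>1 = i\<^sub>2"
  proof (rule linorder_cases)
    assume "i\<^sub>1 < i\<^sub>2"
    then show ?thesis using im1(1,7) im2(2) im2(6)[of "i\<^sub>1 + 1"] by auto
  next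
    assume "i\<^sub>2 < i\<^sub>1"
    then show ?thesis using im2(1,7) im1(2) im1(6)[of "i\<^sub>2 + 1"] by auto
  qed
  obtain t\<^sub>1 b\<^sub>1 t\<^sub>2 b\<^sub>2 where \<omega>: "\<omega>\<^sub>1 = (t\<^sub>1, b\<^sub>1)" "\<omega>\<^sub>2 = (t\<^sub>2, b\<^sub>2)"
    by (cases \<omega>\<^sub>1, cases \<omega>\<^sub>2)
  have len: "length t\<^sub>1 = n" "length b\<^sub>1 = n" "length t\<^sub>2 = n" "length b\<^sub>2 = n"
    using assms(3,4) by (auto simp: \<omega> complete_configs_iff)
  define d where "d = min (i\<^sub>1 + 1) n"
  have d: "1 \<le> d" "d \<le> n" "j + 1 \<le> d" "1 \<le> j + 1"
    using im1(1,2) by (auto simp: d_def)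
  have eqs: "insert_cell (j + 1) White (delete_cell d t\<^sub>1) = insert_cell (j + 1) White (delete_cell d t\<^sub>2)"
    "insert_cell (j + 1) Black (delete_cell d b\<^sub>1) = insert_cell (j + 1) Black (delete_cell d b\<^sub>2)"
    "cell t\<^sub>1 d = cell t\<^sub>2 d" "cell b\<^sub>1 d = cell b\<^sub>2 d"
    using assms(1,2) unfolding left_move_def \<omega> i d_def by auto
  have "t\<^sub>1 = t\<^sub>2" "b\<^sub>1 = b\<^sub>2"
    using insert_cell_inject[OF eqs(1)] insert_cell_inject[OF eqs(2)] eqs(3,4) d len
    by (auto simp: length_delete_cell intro: delete_cell_inject)
  then show ?thesis
    by (simp add: i \<omega>)
qed

text \<open>As for left moves, with the contradiction at the cell left of the larger wall: it would
  be white as the end of one run and black inside the other.\<close>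

lemma right_move_inject:
  assumes "right_move n \<omega>\<^sub>1 i\<^sub>1 \<omega>' j" "right_move n \<omega>\<^sub>2 i\<^sub>2 \<omega>' j"
    "\<omega>\<^sub>1 \<in> complete_configs n" "\<omega>\<^sub>2 \<in> complete_configs n"
  shows "\<omega>\<^sub>1 = \<omega>\<^sub>2 \<and> i\<^sub>1 = i\<^sub>2"
proof -
  note im1 = right_move_image[OF assms(1,3)] and im2 = right_move_image[OF assms(2,4)]
  have i: "i\<^sub>1 = i\<^sub>2"
  proof (rule linorder_cases)
    assume "i\<^sub>1 < i\<^sub>2"
    then show ?thesis using im2(1,6) im1(5)[of "i\<^sub>2"] by auto
  next
    assume "i\<^sub>2 < i\<^sub>1"
    then show ?thesis using im1(1,6) im2(5)[of "i\<^sub>1"] by auto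
  qed
  obtain t\<^sub>1 b\<^sub>1 t\<^sub>2 b\<^sub>2 where \<omega>: "\<omega>\<^sub>1 = (t\<^sub>1, b\<^sub>1)" "\<omega>\<^sub>2 = (t\<^sub>2, b\<^sub>2)"
    by (cases \<omega>\<^sub>1, cases \<omega>\<^sub>2)
  have len: "length t\<^sub>1 = n" "length b\<^sub>1 = n" "length t\<^sub>2 = n" "length b\<^sub>2 = n"
    using assms(3,4) by (auto simp: \<omega> complete_configs_iff)
  define d w where "d = max i\<^sub>1 1" and "w = min (j + 1) n"
  have d: "1 \<le> d" "d \<le> n" "1 \<le> j" "j \<le> n" "1 \<le> w" "w \<le> n" "i\<^sub>1 + 1 \<le> n"
    using im1(1,2) by (auto simp: d_def w_def)
  have eqs: "insert_cell j Black (delete_cell d t\<^sub>1) = insert_cell j Black (delete_cell d t\<^sub>2)"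
    "insert_cell w White (delete_cell (i\<^sub>1 + 1) b\<^sub>1) = insert_cell w White (delete_cell (i\<^sub>1 + 1) b\<^sub>2)"
    "cell t\<^sub>1 d = cell t\<^sub>2 d" "cell b\<^sub>1 (i\<^sub>1 + 1) = cell b\<^sub>2 (i\<^sub>1 + 1)"
    using assms(1,2) unfolding right_move_def \<omega> i d_def w_def by auto
  have "delete_cell d t\<^sub>1 = delete_cell d t\<^sub>2"
    using insert_cell_inject[OF eqs(1)] d len by (simp add: length_delete_cell)
  moreover have "delete_cell (i\<^sub>1 + 1) b\<^sub>1 = delete_cell (i\<^sub>1 + 1) b\<^sub>2"
    using insert_cell_inject[OF eqs(2)] d len by (simp add: length_delete_cell)
  ultimately have "t\<^sub>1 = t\<^sub>2" "b\<^sub>1 = b\<^sub>2"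
    using eqs(3,4) d len by (auto intro: delete_cell_inject)
  then show ?thesis
    by (simp add: i \<omega>)
qed

definition extended_step :: "nat \<Rightarrow> config \<times> nat \<Rightarrow> config \<times> nat" where
  "extended_step n q = (step n (fst q) (snd q), target_wall n (fst q) (snd q))"

text \<open>On a finite set injectivity suffices. The kind of move can be read off at wall
  \<open>j\<close>: after a move there is black or the border on its left and white or the border on
  its right, which never holds after an idle step. A left move has \<open>j < n\<close> and leaves a
  black bottom cell \<open>j + 1\<close>, whereas a right move with \<open>j < n\<close> leaves a
  white one.\<close>

lemma bij_betw_extended_step:
  assumes "1 \<le> n"
  shows "bij_betw (extended_step n) (complete_configs n \<times> {0..n}) (complete_configs n \<times> {0..n})"
proof -
  let ?U = "complete_configs n \<times> {0..n}"
  have "inj_on (extended_step n) ?U"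
  proof (rule inj_onI)
    fix p q assume "p \<in> ?U" "q \<in> ?U" and pq: "extended_step n p = extended_step n q"
    then obtain \<omega>\<^sub>1 i\<^sub>1 \<omega>\<^sub>2 i\<^sub>2 where p: "p = (\<omega>\<^sub>1, i\<^sub>1)" "\<omega>\<^sub>1 \<in> complete_configs n" "i\<^sub>1 \<le> n"
      and q: "q = (\<omega>\<^sub>2, i\<^sub>2)" "\<omega>\<^sub>2 \<in> complete_configs n" "i\<^sub>2 \<le> n"
      by auto
    define \<omega>' j where "\<omega>' = step n \<omega>\<^sub>1 i\<^sub>1" and "j = target_wall n \<omega>\<^sub>1 i\<^sub>1"
    have 1: "left_move n \<omega>\<^sub>1 i\<^sub>1 \<omega>' j \<or> right_move n \<omega>\<^sub>1 i\<^sub>1 \<omega>' j \<or> no_move n \<omega>\<^sub>1 i\<^sub>1 \<omega>' j"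
      using step_cases[OF assms p(2,3)] by (simp add: \<omega>'_def j_def)
    have 2: "left_move n \<omega>\<^sub>2 i\<^sub>2 \<omega>' j \<or> right_move n \<omega>\<^sub>2 i\<^sub>2 \<omega>' j \<or> no_move n \<omega>\<^sub>2 i\<^sub>2 \<omega>' j"
      using step_cases[OF assms q(2,3)] pq by (simp add: \<omega>'_def j_def extended_step_def p q)
    have LR: False if "left_move n \<omega> i \<omega>' j" "\<omega> \<in> complete_configs n"
        "right_move n \<psi> k \<omega>' j" "\<psi> \<in> complete_configs n" for \<omega> i \<psi> k
      using left_move_image(1,2,5)[OF that(1,2)] right_move_image(4)[OF that(3,4)] by auto
    have LN: False if "left_move n \<omega> i \<omega>' j" "\<omega> \<in> complete_configs n" "no_move n \<psi> k \<omega>' j"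
      for \<omega> i \<psi> k
      using left_move_image(3,4)[OF that(1,2)] that(3) by (auto simp: no_move_def)
    have RN: False if "right_move n \<omega> i \<omega>' j" "\<omega> \<in> complete_configs n" "no_move n \<psi> k \<omega>' j"
      for \<omega> i \<psi> k
      using right_move_image(1,3)[OF that(1,2)] right_move_image(5)[OF that(1,2), of j] that(3)
      by (auto simp: no_move_def)
    have NN: "\<omega>\<^sub>1 = \<omega>\<^sub>2 \<and> i\<^sub>1 = i\<^sub>2" if "no_move n \<omega>\<^sub>1 i\<^sub>1 \<omega>' j" "no_move n \<omega>\<^sub>2 i\<^sub>2 \<omega>' j"
      using that by (auto simp: no_move_def)
    have "\<omega>\<^sub>1 = \<omega>\<^sub>2 \<and> i\<^sub>1 = i\<^sub>2"
      using 1 2 LR LN RN NN left_move_inject right_move_inject p(2) q(2) by metis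
    then show "p = q"
      by (simp add: p q)
  qed
  moreover have "extended_step n ` ?U \<subseteq> ?U"
    using step_complete[OF assms] by (auto simp: extended_step_def)
  ultimately show ?thesis
    by (simp add: bij_betw_def endo_inj_surj finite_complete_configs)
qed

subsection \<open>Reaching the configuration with a white top row\<close>

text \<open>On the top row the chain is the TASEP; moving a particle to the right or letting it exit
  lowers the top row's height function.\<close>

lemma step_lowers_top:
  assumes n: "1 \<le> n" and \<omega>: "\<omega> \<in> complete_configs n" and i: "1 \<le> i" "i \<le> n"
    and "cell (fst \<omega>) i = Black" "i < n \<Longrightarrow> cell (fst \<omega>) (i + 1) = White"
  shows "(\<Sum>k\<le>n. height (fst (step n \<omega> i)) k) < (\<Sum>k\<le>n. height (fst \<omega>) k)"
proof -
  define t where "t = fst \<omega>"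
  have len: "length t = n"
    using \<omega> by (cases \<omega>) (auto simp: t_def complete_configs_iff)
  have ti: "height t i = height t (i - 1) + 1"
    using height_Suc[of t "i - 1"] assms by (simp add: t_def)
  have step1: "height t (k - 1) - 1 \<le> height t k" "height t (Suc k) - 1 \<le> height t k" for k
    using height_Suc[of t "k - 1"] height_Suc[of t k]
      charge_bounds[of "cell t k"] charge_bounds[of "cell t (Suc k)"] by (cases k; simp)+
  \<comment> \<open>Either kind of move lowers the height at wall \<open>i\<close> by 2: a local
    peak of the path, or its final up-step when \<open>i = n\<close>, is turned downwards.\<close>
  have "(\<forall>k. height (fst (step n \<omega> i)) k \<le> height t k) \<and> height (fst (step n \<omega> i)) i < height t i"
    using step_cases[OF n \<omega> i(2)]
  proof (elim disjE)
    assume "left_move n \<omega> i (step n \<omega> i) (target_wall n \<omega> i)"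
    then obtain j d where d: "d = min (i + 1) n" "j = left_end t i"
        "charge (cell t d) = (if i < n then -1 else 1)"
      and t': "fst (step n \<omega> i) = insert_cell (j + 1) White (delete_cell d t)"
      by (auto simp: left_move_def t_def)
    have j: "1 \<le> j + 1" "j + 1 \<le> d" "1 \<le> d" "d \<le> n" "j < i" "i \<le> d"
      using d i left_end(1)[of i t] by auto
    have "height (fst (step n \<omega> i)) k =
        (if k \<le> j then height t k else if k \<le> d then height t (k - 1) - 1
         else height t k - charge (cell t d) - 1)" for k
      using j len by (auto simp: t' height_insert_cell length_delete_cell height_delete_cell)
    then show ?thesis
      using j ti step1 d by auto
  next
    assume "right_move n \<omega> i (step n \<omega> i) (target_wall n \<omega> i)"
    then obtain j d where d: "i < n" "d = i" "j = right_end n t i" "charge (cell t d) = 1"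
        "cell t (i + 1) = White"
      and t': "fst (step n \<omega> i) = insert_cell j Black (delete_cell d t)"
      using i by (auto simp: right_move_def t_def)
    have j: "i < j" "j \<le> n" "1 \<le> d" "d \<le> n"
      using d i right_end(1,2)[of i n t] by auto
    have "height (fst (step n \<omega> i)) k =
        (if k < i then height t k else if k < j then height t (Suc k) - 1 else height t k)" for k
      using j len d(2,4) by (auto simp: t' height_insert_cell length_delete_cell height_delete_cell)
    then show ?thesis
      using j step1 d(5) height_Suc[of t i] by auto
  qed (use assms in \<open>auto simp: no_move_def\<close>)
  then show ?thesis
    unfolding t_def using i by (intro sum_strict_mono_ex1) auto
qed

text \<open>A white top row has height \<open>- n\<close>, so the bottom row must attain the largest
  possible height \<open>n\<close>, which forces every one of its cells to be black.\<close>

lemma top_white_config: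
  assumes "(t, b) \<in> complete_configs n" "\<And>k. 1 \<le> k \<Longrightarrow> k \<le> n \<Longrightarrow> cell t k = White"
  shows "(t, b) = (replicate n White, replicate n Black)"
proof -
  have len: "length t = n" "length b = n" and sum: "height t n + height b n = 0"
    using assms(1) by (auto simp: complete_configs_iff)
  have "height t n = - int n"
    using assms(2) by (simp add: height_def)
  then have "(\<Sum>k=1..n. 1 - charge (cell b k)) = 0"
    using sum by (simp add: height_def sum_subtractf)
  then have "\<forall>k\<in>{1..n}. 1 - charge (cell b k) = 0"
    by (subst (asm) sum_nonneg_eq_0_iff) (auto simp: charge_bounds)
  then have "charge (cell b k) = 1" if "1 \<le> k" "k \<le> n" for k
    using that by simp
  then have "cell b k = Black" if "1 \<le> k" "k \<le> n" for k
    using that by (metis charge.simps(2) not_White_iff one_neq_neg_one)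
  then have "b = replicate n Black"
    using len by (intro row_eqI[of _ n]) (auto simp: cell_def)
  moreover have "t = replicate n White"
    using len assms(2) by (intro row_eqI[of _ n]) (auto simp: cell_def)
  ultimately show ?thesis by simp
qed

text \<open>Take an element of \<open>C\<close> that minimises the sum of the top heights. A black
  particle in its top row would permit a step inside \<open>C\<close> that lowers this sum.\<close>

lemma step_closed_contains_white_top:
  assumes n: "1 \<le> n" and C: "C \<subseteq> complete_configs n" "C \<noteq> {}"
    and closed: "\<And>\<omega> i. \<omega> \<in> C \<Longrightarrow> i \<le> n \<Longrightarrow> step n \<omega> i \<in> C"
  shows "(replicate n White, replicate n Black) \<in> C"
proof -
  define \<Phi> where "\<Phi> = (\<lambda>\<omega> :: config. \<Sum>k\<le>n. height (fst \<omega>) k)"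
  have "finite C"
    using C(1) finite_complete_configs finite_subset by blast
  then obtain \<omega> where \<omega>: "\<omega> \<in> C" "\<And>\<psi>. \<psi> \<in> C \<Longrightarrow> \<Phi> \<omega> \<le> \<Phi> \<psi>"
    using C(2) arg_min_if_finite(1) arg_min_least by metis
  have "cell (fst \<omega>) k = White" if k: "1 \<le> k" "k \<le> n" for k
  proof (rule ccontr)
    assume "cell (fst \<omega>) k \<noteq> White"
    \<comment> \<open>The last black particle is followed by a white one or by the right border, so
      it is free to move.\<close>
    define B where "B = {k \<in> {1..n}. cell (fst \<omega>) k = Black}"
    have "k \<in> B"
      using k \<open>cell (fst \<omega>) k \<noteq> White\<close> by (auto simp: B_def not_White_iff)
    moreover have finB: "finite B" by (simp add: B_def)
    ultimately have i: "Max B \<in> B" by (intro Max_in) auto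
    have "cell (fst \<omega>) (Max B + 1) = White" if "Max B < n"
    proof (rule ccontr)
      assume "cell (fst \<omega>) (Max B + 1) \<noteq> White"
      then have "Max B + 1 \<in> B"
        using that by (auto simp: B_def not_White_iff)
      then have "Max B + 1 \<le> Max B"
        using finB by (rule Max_ge[rotated])
      then show False by simp
    qed
    then have "\<Phi> (step n \<omega> (Max B)) < \<Phi> \<omega>"
      unfolding \<Phi>_def using i \<omega>(1) C(1) n by (intro step_lowers_top) (auto simp: B_def)
    moreover have "step n \<omega> (Max B) \<in> C"
      using closed \<omega>(1) i by (auto simp: B_def)
    ultimately show False
      using \<omega>(2)[of "step n \<omega> (Max B)"] by simp
  qed
  then show ?thesis
    using top_white_config[of "fst \<omega>" "snd \<omega>" n] \<omega>(1) C(1) by auto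
qed

section \<open>Unit rates and the stationary law\<close>

lemma chain_kernel_unit_rates:
  "chain_kernel 1 1 1 n \<omega> = map_pmf (step n \<omega>) (pmf_of_set {0..n})"
proof -
  \<comment> \<open>At rate 1 every chosen move is carried out, so the only randomness left is the
    uniform wall.\<close>
  have "bernoulli_pmf 1 = return_pmf True"
    by (rule pmf_eqI) (auto simp: indicator_def split: bool.splits)
  moreover have "wall_rate 1 1 1 n i = 1" for i
    by (simp add: wall_rate_def)
  ultimately show ?thesis
    by (simp add: chain_kernel_def map_pmf_def bind_return_pmf)
qed

theorem theorem2:
  fixes n :: nat and \<pi> :: "config pmf"
  assumes "n \<ge> 1"
  shows "stationary_distribution (complete_configs n) (chain_kernel 1 1 1 n) \<pi> \<longleftrightarrow>
         \<pi> = pmf_of_set (complete_configs n)"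
proof -
  have K: "chain_kernel 1 1 1 n \<omega> =
      map_pmf (\<lambda>i. fst (extended_step n (\<omega>, i))) (pmf_of_set {0..n})" for \<omega>
    by (simp add: chain_kernel_unit_rates extended_step_def)
  note bij = bij_betw_extended_step[OF assms]
  \<comment> \<open>The configuration with a white top row serves as the state common to all
    nonempty closed sets.\<close>
  have reach: "(replicate n White, replicate n Black) \<in> C"
    if "C \<subseteq> complete_configs n" "C \<noteq> {}"
      "\<And>\<omega> i. \<omega> \<in> C \<Longrightarrow> i \<in> {0..n} \<Longrightarrow> fst (extended_step n (\<omega>, i)) \<in> C" for C
    using step_closed_contains_white_top[OF assms that(1,2)] that(3) by (simp add: extended_step_def)
  show ?thesis
  proof
    assume "stationary_distribution (complete_configs n) (chain_kernel 1 1 1 n) \<pi>"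
    then show "\<pi> = pmf_of_set (complete_configs n)"
      by (intro stationary_shuffle_unique[OF finite_complete_configs _ _ bij K reach]) simp_all
  next
    assume "\<pi> = pmf_of_set (complete_configs n)"
    then show "stationary_distribution (complete_configs n) (chain_kernel 1 1 1 n) \<pi>"
      using uniform_stationary_shuffle[OF finite_complete_configs _ complete_configs_nonempty _ bij K]
      by simp
  qed
qed

end
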